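(* Let $R$ be a unital commutative ring and let $M$ be a free $R$-module with basis $\{e_i : i \in I\}$. Assume that at least one of the following holds: (A) for every integer $n$ with $1 \leqslant n \leqslant |I|$, the element $n = 1 + \cdots + 1$ ($n$ times) of $R$ is not a zerodivisor; (B) $R$ is an integral domain that is either infinite, or finite with $\dim M = |I| < |R|$. For every finite subset $J \subseteq I$, fix a vector $m_J := \sum_{j \in J} c_j^J e_j \in M$, where every $c_j^J \in R$ is a non-zerodivisor. Let $f : M \to R$ be any map such that the restriction of $f$ to each of the following lines is affine-linear: \[ m_0 + R e_i = \{ m_0 + r e_i : r \in R \} \quad \text{for all } m_0 \in M \text{ and all } i \in I, \] \[ R m_J = \{ r m_J : r \in R \} \quad \text{for all finite } J \subseteq I \text{ with } |J| \geqslant 2. \] Then $f$ is affine-linear on $M$.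
   Context: Let $R$ be a unital commutative ring, $N \leqslant M$ two $R$-modules, and $m_0 \in M$. An $R$-valued function $f$ on the affine submodule $\ell := m_0 + N \subseteq M$ is called affine-linear if for all $m_1 \in \ell$, the map $f_{m_1} : N \to R$, $n \mapsto f(n + m_1) - f(m_1)$, is $R$-linear. (The case $N = Re$ gives affine-linearity along the line $m_0 + Re$; the case $N = M$ gives affine-linearity on $M$.) *)

theory Defs
  imports "HOL-Algebra.Module" "HOL-Algebra.AbelCoset"
begin

text \<open>Zero is a non-zerodivisor only in the trivial ring.\<close>

definition nonzerodivisor :: "('r, 'x) ring_scheme \<Rightarrow> 'r \<Rightarrow> bool"
  where "nonzerodivisor R a \<longleftrightarrow>
    a \<in> carrier R \<and> (\<forall>b\<in>carrier R. a \<otimes>\<^bsub>R\<^esub> b = \<zero>\<^bsub>R\<^esub> \<longrightarrow> b = \<zero>\<^bsub>R\<^esub>)"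

text \<open>\<open>I\<close> may be infinite; only finite linear combinations of the family \<open>e\<close> occur.\<close>

definition is_basis ::
    "('r, 'x) ring_scheme \<Rightarrow> ('r, 'm, 'y) module_scheme \<Rightarrow> 'i set \<Rightarrow> ('i \<Rightarrow> 'm) \<Rightarrow> bool"
  where "is_basis R M I e \<longleftrightarrow>
    e \<in> I \<rightarrow> carrier M \<and>
    (\<forall>J a. finite J \<and> J \<subseteq> I \<and> a \<in> J \<rightarrow> carrier R \<and>
        (\<Oplus>\<^bsub>M\<^esub>j\<in>J. a j \<odot>\<^bsub>M\<^esub> e j) = \<zero>\<^bsub>M\<^esub> \<longrightarrow> (\<forall>j\<in>J. a j = \<zero>\<^bsub>R\<^esub>)) \<and>
    (\<forall>m\<in>carrier M. \<exists>J a. finite J \<and> J \<subseteq> I \<and> a \<in> J \<rightarrow> carrier R \<and>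
        m = (\<Oplus>\<^bsub>M\<^esub>j\<in>J. a j \<odot>\<^bsub>M\<^esub> e j))"

definition cyclic_submodule ::
    "('r, 'x) ring_scheme \<Rightarrow> ('r, 'm, 'y) module_scheme \<Rightarrow> 'm \<Rightarrow> 'm set"
  where "cyclic_submodule R M v = {r \<odot>\<^bsub>M\<^esub> v | r. r \<in> carrier R}"

text \<open>\<open>R\<close>-linearity of a map from the submodule \<open>N\<close> of \<open>M\<close> to \<open>R\<close>, viewed as a module over itself.\<close>

definition linear_form_on ::
    "('r, 'x) ring_scheme \<Rightarrow> ('r, 'm, 'y) module_scheme \<Rightarrow> 'm set \<Rightarrow> ('m \<Rightarrow> 'r) \<Rightarrow> bool"
  where "linear_form_on R M N g \<longleftrightarrow>
    g \<in> N \<rightarrow> carrier R \<and>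
    (\<forall>x\<in>N. \<forall>y\<in>N. g (x \<oplus>\<^bsub>M\<^esub> y) = g x \<oplus>\<^bsub>R\<^esub> g y) \<and>
    (\<forall>r\<in>carrier R. \<forall>x\<in>N. g (r \<odot>\<^bsub>M\<^esub> x) = r \<otimes>\<^bsub>R\<^esub> g x)"

text \<open>Affine-linearity on the affine submodule \<open>m\<^sub>0 + N\<close>; it depends only on the values of \<open>f\<close>
  on that coset.\<close>

definition affine_linear_on ::
    "('r, 'x) ring_scheme \<Rightarrow> ('r, 'm, 'y) module_scheme \<Rightarrow> 'm \<Rightarrow> 'm set \<Rightarrow> ('m \<Rightarrow> 'r) \<Rightarrow> bool"
  where "affine_linear_on R M m\<^sub>0 N f \<longleftrightarrow>
    (\<forall>m\<^sub>1 \<in> m\<^sub>0 <+\<^bsub>M\<^esub> N. linear_form_on R M N (\<lambda>n. f (n \<oplus>\<^bsub>M\<^esub> m\<^sub>1) \<ominus>\<^bsub>R\<^esub> f m\<^sub>1))"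

end

theory Submission
  imports "HOL-Algebra.Multiplicative_Group" Defs
begin

text \<open>Put \<open>h = f - f 0\<close> and show by induction on \<open>S\<close> that \<open>h\<close> is linear on all combinations of
  \<open>{e j | j \<in> S}\<close>. For \<open>n = |S| \<ge> 2\<close>, let \<open>g\<close> be the difference of \<open>h\<close> and its linear part, as a
  function of the coordinates. It is affine in each coordinate and, by induction, vanishes as soon
  as one coordinate does, so \<open>g x = b \<cdot> \<Prod>x\<^sub>j\<close> for a constant \<open>b\<close>. On the line \<open>R m\<^sub>S\<close> linearity
  of \<open>f - f 0\<close> gives \<open>r\<^sup>n d = r d\<close> for all \<open>r\<close>, where \<open>d = b \<cdot> \<Prod>c\<^sub>j\<close>. Both (A) and (B) provide
  \<open>n + 1\<close> points of \<open>R\<close> whose pairwise differences are non-zerodivisors, and a polynomial of degree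
  \<open>n\<close> vanishing at such points has leading coefficient \<open>0\<close>. Hence \<open>d = 0\<close> and \<open>b = 0\<close>.\<close>

section \<open>Non-zerodivisors and ring identities\<close>

lemma nonzerodivisorD:
  "\<lbrakk>nonzerodivisor R a; b \<in> carrier R; a \<otimes>\<^bsub>R\<^esub> b = \<zero>\<^bsub>R\<^esub>\<rbrakk> \<Longrightarrow> b = \<zero>\<^bsub>R\<^esub>"
  by (auto simp: nonzerodivisor_def)

lemma nonzerodivisor_closed: "nonzerodivisor R a \<Longrightarrow> a \<in> carrier R"
  by (simp add: nonzerodivisor_def)

context cring
begin

text \<open>Shows that the remainder \<open>g\<close> keeps the coordinate \<open>a\<close> as a
  factor: \<open>s\<close> is the common value of \<open>h\<close> and of its linear part when this
  coordinate is \<open>0\<close>, \<open>q\<close> is the value of \<open>h\<close> when it is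
  \<open>1\<close>, and \<open>t\<close> is the value of \<open>h\<close> at the basis
  vector.\<close>

lemma affine_remainder_eq:
  "\<lbrakk>s \<in> carrier R; a \<in> carrier R; q \<in> carrier R; t \<in> carrier R\<rbrakk> \<Longrightarrow>
    s \<oplus> a \<otimes> (q \<ominus> s) \<ominus> (s \<oplus> a \<otimes> t) = a \<otimes> (q \<ominus> (s \<oplus> t))"
  by algebra

lemma mult_diff_distrib:
  "\<lbrakk>r \<in> carrier R; a \<in> carrier R; b \<in> carrier R\<rbrakk> \<Longrightarrow> r \<otimes> a \<ominus> r \<otimes> b = r \<otimes> (a \<ominus> b)"
  by algebra

text \<open>Turns additivity of \<open>f\<close> normalised at the origin (with \<open>d\<close> the
  value there) into independence of the increments of \<open>f\<close> from the base point.\<close>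

lemma diff_eq_diff_of_diff_eq_add:
  assumes "a \<in> carrier R" "b \<in> carrier R" "c \<in> carrier R" "d \<in> carrier R"
    and "a \<ominus> d = (b \<ominus> d) \<oplus> (c \<ominus> d)"
  shows "a \<ominus> c = b \<ominus> d"
proof -
  have "a \<ominus> c = a \<ominus> d \<ominus> (c \<ominus> d)"
    using assms(1-4) by algebra
  also have "\<dots> = b \<ominus> d"
    unfolding assms(5) using assms(1-4) by algebra
  finally show ?thesis .
qed

text \<open>Subtracting a constant \<open>d\<close> from all values changes no difference; this
  carries the line equation from \<open>f\<close> to \<open>h\<close>.\<close>

lemma diff_eq_add_mult_diff_shift:
  assumes "a \<in> carrier R" "b \<in> carrier R" "c \<in> carrier R" "d \<in> carrier R"
    and "a \<ominus> b = r \<otimes> (c \<ominus> b)"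
  shows "a \<ominus> d = (b \<ominus> d) \<oplus> r \<otimes> (c \<ominus> d \<ominus> (b \<ominus> d))"
proof -
  have "c \<ominus> d \<ominus> (b \<ominus> d) = c \<ominus> b"
    using assms(1-4) by algebra
  moreover have "a \<ominus> d = (b \<ominus> d) \<oplus> (a \<ominus> b)"
    using assms(1-4) by algebra
  ultimately show ?thesis
    using assms(5) by simp
qed

lemma nonzerodivisor_mult:
  assumes "nonzerodivisor R a" and "nonzerodivisor R b"
  shows "nonzerodivisor R (a \<otimes> b)"
  unfolding nonzerodivisor_def
proof (intro conjI ballI impI)
  note c = assms[THEN nonzerodivisor_closed]
  then show "a \<otimes> b \<in> carrier R" by simp
  fix d assume d: "d \<in> carrier R" and "a \<otimes> b \<otimes> d = \<zero>"
  then have "a \<otimes> (b \<otimes> d) = \<zero>"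
    using c by (simp add: m_assoc)
  then have "b \<otimes> d = \<zero>"
    using nonzerodivisorD[OF assms(1)] c d by blast
  then show "d = \<zero>"
    using nonzerodivisorD[OF assms(2) d] by blast
qed

lemma nonzerodivisor_finprod:
  assumes "finite S" and "\<And>j. j \<in> S \<Longrightarrow> nonzerodivisor R (c j)"
  shows "nonzerodivisor R (\<Otimes>j\<in>S. c j)"
  using assms
proof (induction S)
  case empty
  then show ?case by (simp add: nonzerodivisor_def)
next
  case (insert i S)
  then have "c i \<in> carrier R" "c \<in> S \<rightarrow> carrier R"
    by (auto intro: nonzerodivisor_closed)
  then show ?case
    using insert by (simp add: nonzerodivisor_mult)
qed

lemma nonzerodivisor_uminus:
  assumes "nonzerodivisor R a" shows "nonzerodivisor R (\<ominus> a)"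
  using assms by (auto simp: nonzerodivisor_def l_minus)

section \<open>Polynomial functions and divided differences\<close>

text \<open>Polynomial functions of degree at most \<open>n\<close> whose coefficient of degree \<open>n\<close> is \<open>b\<close>,
  characterised through their divided differences. A function can have several such \<open>b\<close>.\<close>

primrec poly_fun :: "nat \<Rightarrow> 'a \<Rightarrow> ('a \<Rightarrow> 'a) \<Rightarrow> bool" where
  "poly_fun 0 b p \<longleftrightarrow> b \<in> carrier R \<and> (\<forall>r\<in>carrier R. p r = b)"
| "poly_fun (Suc n) b p \<longleftrightarrow> p \<in> carrier R \<rightarrow> carrier R \<and>
     (\<forall>x\<in>carrier R. \<exists>q. poly_fun n b q \<and>
       (\<forall>r\<in>carrier R. p r = p x \<oplus> (r \<ominus> x) \<otimes> q r))"

lemma poly_fun_SucI: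
  assumes "\<And>r. r \<in> carrier R \<Longrightarrow> p r \<in> carrier R"
    and "\<And>x. x \<in> carrier R \<Longrightarrow> poly_fun n b (q x)"
    and "\<And>x r. \<lbrakk>x \<in> carrier R; r \<in> carrier R\<rbrakk> \<Longrightarrow> p r = p x \<oplus> (r \<ominus> x) \<otimes> q x r"
  shows "poly_fun (Suc n) b p"
  unfolding poly_fun.simps using assms by blast

lemma poly_fun_SucD:
  assumes "poly_fun (Suc n) b p"
  obtains q where "\<And>x. x \<in> carrier R \<Longrightarrow> poly_fun n b (q x)"
    and "\<And>x r. \<lbrakk>x \<in> carrier R; r \<in> carrier R\<rbrakk> \<Longrightarrow> p r = p x \<oplus> (r \<ominus> x) \<otimes> q x r"
  using assms unfolding poly_fun.simps by metis

lemma poly_fun_closed: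
  assumes "poly_fun n b p" and "r \<in> carrier R"
  shows "p r \<in> carrier R"
  using assms by (cases n) auto

lemma poly_fun_coeff_closed: "poly_fun n b p \<Longrightarrow> b \<in> carrier R"
proof (induction n arbitrary: p)
  case (Suc n)
  then show ?case
    by (meson poly_fun_SucD zero_closed)
qed simp

lemma poly_fun_add:
  assumes "poly_fun n a p" and "poly_fun n b q"
  shows "poly_fun n (a \<oplus> b) (\<lambda>r. p r \<oplus> q r)"
  using assms
proof (induction n arbitrary: p q)
  case 0
  then show ?case by auto
next
  case (Suc n)
  note cl = Suc.prems[THEN poly_fun_closed]
  obtain p' where p': "\<And>x. x \<in> carrier R \<Longrightarrow> poly_fun n a (p' x)"
      "\<And>x r. \<lbrakk>x \<in> carrier R; r \<in> carrier R\<rbrakk> \<Longrightarrow> p r = p x \<oplus> (r \<ominus> x) \<otimes> p' x r"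
    using Suc.prems(1) by (rule poly_fun_SucD) blast
  obtain q' where q': "\<And>x. x \<in> carrier R \<Longrightarrow> poly_fun n b (q' x)"
      "\<And>x r. \<lbrakk>x \<in> carrier R; r \<in> carrier R\<rbrakk> \<Longrightarrow> q r = q x \<oplus> (r \<ominus> x) \<otimes> q' x r"
    using Suc.prems(2) by (rule poly_fun_SucD) blast
  show ?case
  proof (rule poly_fun_SucI)
    fix x r assume xr: "x \<in> carrier R" "r \<in> carrier R"
    have "p x \<in> carrier R" "q x \<in> carrier R" "p' x r \<in> carrier R" "q' x r \<in> carrier R"
        "r \<ominus> x \<in> carrier R"
      using cl xr p'(1)[THEN poly_fun_closed] q'(1)[THEN poly_fun_closed] by auto
    then show "p r \<oplus> q r = p x \<oplus> q x \<oplus> (r \<ominus> x) \<otimes> (p' x r \<oplus> q' x r)"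
      by (subst p'(2)[OF xr], subst q'(2)[OF xr]) (simp add: r_distr a_ac)
  qed (use cl Suc.IH p'(1) q'(1) in auto)
qed

lemma poly_fun_smult:
  assumes "poly_fun n b p" and "a \<in> carrier R"
  shows "poly_fun n (a \<otimes> b) (\<lambda>r. a \<otimes> p r)"
  using assms(1)
proof (induction n arbitrary: p)
  case 0
  then show ?case using assms(2) by auto
next
  case (Suc n)
  note cl = Suc.prems[THEN poly_fun_closed]
  obtain p' where p': "\<And>x. x \<in> carrier R \<Longrightarrow> poly_fun n b (p' x)"
      "\<And>x r. \<lbrakk>x \<in> carrier R; r \<in> carrier R\<rbrakk> \<Longrightarrow> p r = p x \<oplus> (r \<ominus> x) \<otimes> p' x r"
    using Suc.prems(1) by (rule poly_fun_SucD) blast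
  show ?case
  proof (rule poly_fun_SucI)
    fix x r assume xr: "x \<in> carrier R" "r \<in> carrier R"
    have "p x \<in> carrier R" "p' x r \<in> carrier R" "r \<ominus> x \<in> carrier R"
      using cl xr p'(1)[THEN poly_fun_closed] by auto
    then show "a \<otimes> p r = a \<otimes> p x \<oplus> (r \<ominus> x) \<otimes> (a \<otimes> p' x r)"
      using assms(2) by (subst p'(2)[OF xr]) (simp add: r_distr m_ac)
  qed (use cl assms(2) Suc.IH p'(1) in auto)
qed

text \<open>A constant has divided difference \<open>0\<close>; in higher degree the old divided
  differences serve again, with their degree raised by induction. Terms of lower degree thus enter a
  sum with coefficient \<open>0\<close>.\<close>

lemma poly_fun_raise: "poly_fun n b p \<Longrightarrow> poly_fun (Suc n) \<zero> p"
proof (induction n arbitrary: p)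
  case 0
  then show ?case
    by (intro poly_fun_SucI[where q = "\<lambda>_ _. \<zero>"]) auto
next
  case (Suc n)
  obtain q where q: "\<And>x. x \<in> carrier R \<Longrightarrow> poly_fun n b (q x)"
      "\<And>x r. \<lbrakk>x \<in> carrier R; r \<in> carrier R\<rbrakk> \<Longrightarrow> p r = p x \<oplus> (r \<ominus> x) \<otimes> q x r"
    using Suc.prems by (rule poly_fun_SucD) blast
  show ?case
    by (rule poly_fun_SucI[OF poly_fun_closed[OF Suc.prems] Suc.IH[OF q(1)] q(2)])
qed

lemma poly_fun_less:
  assumes "poly_fun n b p" and "n < m"
  shows "poly_fun m \<zero> p"
  using assms(2)
proof (induction m)
  case (Suc m)
  then show ?case
    using assms(1) by (cases "n = m") (auto simp del: poly_fun.simps intro: poly_fun_raise)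
qed simp

text \<open>Since r p(r) - x p(x) = (r - x) p(r) + x (p(r) - p(x)), the divided difference of the
  product at \<open>x\<close> is p(r) + x q(x, r). Its second summand has degree below
  \<open>n\<close>, so the coefficient of degree \<open>n\<close> remains \<open>b\<close>.\<close>

lemma poly_fun_times_var:
  assumes "poly_fun n b p"
  shows "poly_fun (Suc n) b (\<lambda>r. r \<otimes> p r)"
proof (cases n)
  case 0
  then have b: "b \<in> carrier R" "\<And>r. r \<in> carrier R \<Longrightarrow> p r = b"
    using assms by auto
  show ?thesis
  \<comment> \<open>\<open>poly_fun 0\<close> supplies no divided difference of \<open>p\<close>; as
    \<open>p\<close> is constant, that summand is zero and \<open>p\<close> alone remains.\<close>
  proof (rule poly_fun_SucI[where q = "\<lambda>_. p"])
    fix x r assume xr: "x \<in> carrier R" "r \<in> carrier R"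
    show "r \<otimes> p r = x \<otimes> p x \<oplus> (r \<ominus> x) \<otimes> p r"
      unfolding b(2)[OF xr(1)] b(2)[OF xr(2)] using xr b(1) by algebra
  qed (use assms b in auto)
next
  case (Suc k)
  note cl = assms[THEN poly_fun_closed]
  obtain q where q: "\<And>x. x \<in> carrier R \<Longrightarrow> poly_fun k b (q x)"
      "\<And>x r. \<lbrakk>x \<in> carrier R; r \<in> carrier R\<rbrakk> \<Longrightarrow> p r = p x \<oplus> (r \<ominus> x) \<otimes> q x r"
    using assms unfolding Suc by (rule poly_fun_SucD) blast
  show ?thesis
  proof (rule poly_fun_SucI)
    fix x assume x: "x \<in> carrier R"
    have "poly_fun n (b \<oplus> \<zero>) (\<lambda>r. p r \<oplus> x \<otimes> q x r)"
      using poly_fun_add[OF assms] poly_fun_raise[OF poly_fun_smult[OF q(1)]] x Suc by blast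
    then show "poly_fun n b (\<lambda>r. p r \<oplus> x \<otimes> q x r)"
      using poly_fun_coeff_closed[OF assms] by simp
    fix r assume r: "r \<in> carrier R"
    have c: "p x \<in> carrier R" "q x r \<in> carrier R"
      using cl x r q(1)[THEN poly_fun_closed] by auto
    show "r \<otimes> p r = x \<otimes> p x \<oplus> (r \<ominus> x) \<otimes> (p r \<oplus> x \<otimes> q x r)"
      unfolding q(2)[OF x r] using c x r by algebra
  qed (use cl in auto)
qed

text \<open>Lets \<open>poly_fun_monom\<close> rewrite a power by ring laws that are available only
  for arguments in the carrier.\<close>

lemma poly_fun_cong:
  assumes "\<And>r. r \<in> carrier R \<Longrightarrow> p r = q r"
  shows "poly_fun n b p \<longleftrightarrow> poly_fun n b q"
  using assms by (cases n) (auto simp: Pi_iff cong: ball_cong)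

lemma poly_fun_monom:
  assumes "d \<in> carrier R"
  shows "poly_fun n d (\<lambda>r. r [^] n \<otimes> d)"
proof (induction n)
  case 0
  then show ?case using assms by simp
next
  case (Suc n)
  have "r [^] Suc n \<otimes> d = r \<otimes> (r [^] n \<otimes> d)" if "r \<in> carrier R" for r
    using assms that by (simp add: m_ac)
  then show ?case
    using poly_fun_times_var[OF Suc] by (simp only: cong: poly_fun_cong)
qed

text \<open>Splitting off the root \<open>x (Suc n)\<close> leaves a quotient of degree one less
  with the same coefficient \<open>b\<close>. It vanishes at the remaining points because the
  factors \<open>x k \<ominus> x (Suc n)\<close> can be cancelled. At degree \<open>0\<close> the
  quotient is the constant \<open>b\<close>, and the one point left gives the claim.\<close>

lemma poly_fun_coeff_eq_zero:
  assumes "poly_fun n b p"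
    and "\<And>k. k \<le> n \<Longrightarrow> x k \<in> carrier R \<and> p (x k) = \<zero>"
    and "\<And>k l. k < l \<Longrightarrow> l \<le> n \<Longrightarrow> nonzerodivisor R (x k \<ominus> x l)"
  shows "b = \<zero>"
  using assms
proof (induction n arbitrary: p)
  case 0
  then show ?case by force
next
  case (Suc n)
  have xn: "x (Suc n) \<in> carrier R" "p (x (Suc n)) = \<zero>"
    using Suc.prems(2) by blast+
  then obtain q where q: "poly_fun n b q"
      "\<And>r. r \<in> carrier R \<Longrightarrow> p r = p (x (Suc n)) \<oplus> (r \<ominus> x (Suc n)) \<otimes> q r"
    by (metis poly_fun_SucD[OF Suc.prems(1)])
  have "q (x k) = \<zero>" if k: "k \<le> n" for k
  proof (rule nonzerodivisorD)
    show "nonzerodivisor R (x k \<ominus> x (Suc n))"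
      using Suc.prems(3) k by simp
    show "q (x k) \<in> carrier R"
      using poly_fun_closed[OF q(1)] Suc.prems(2) k by simp
    then show "(x k \<ominus> x (Suc n)) \<otimes> q (x k) = \<zero>"
      using q(2)[of "x k"] Suc.prems(2)[of k] xn k by simp
  qed
  then show ?case
    using Suc.IH[OF q(1)] Suc.prems(2,3) by simp
qed

lemma eq_zero_of_pow_mult_eq:
  assumes d: "d \<in> carrier R" and n: "(n::nat) \<ge> 2"
    and eq: "\<And>r. r \<in> carrier R \<Longrightarrow> r [^] n \<otimes> d = r \<otimes> d"
    and x: "\<And>k. k \<le> n \<Longrightarrow> x k \<in> carrier R"
    and nzd: "\<And>k l. k < l \<Longrightarrow> l \<le> n \<Longrightarrow> nonzerodivisor R (x k \<ominus> x l)"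
  shows "d = \<zero>"
proof -
  \<comment> \<open>The function is r^n d - r d, zero on all of \<open>R\<close>. Because 1 <
    \<open>n\<close>, the linear term contributes \<open>\<zero>\<close> to the coefficient of
    degree \<open>n\<close>, which is therefore \<open>d\<close>.\<close>
  have "poly_fun n (d \<oplus> \<zero>) (\<lambda>r. r [^] n \<otimes> d \<oplus> r [^] (1::nat) \<otimes> \<ominus> d)"
    using d n by (intro poly_fun_add poly_fun_less[OF poly_fun_monom] poly_fun_monom) auto
  then have "d \<oplus> \<zero> = \<zero>"
    by (rule poly_fun_coeff_eq_zero[where x = x]) (use x nzd eq d in \<open>auto simp: r_minus r_neg\<close>)
  then show ?thesis using d by simp
qed

section \<open>Points with non-zerodivisor differences\<close>

lemma ex_nonzerodivisor_differences_char:
  assumes "\<And>k. 1 \<le> k \<Longrightarrow> k \<le> n \<Longrightarrow> nonzerodivisor R ([(k::nat)] \<cdot> \<one>)"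
  shows "\<exists>x. (\<forall>k\<le>n. x k \<in> carrier R) \<and>
    (\<forall>k l. k < l \<longrightarrow> l \<le> n \<longrightarrow> nonzerodivisor R (x k \<ominus> x l))"
proof -
  \<comment> \<open>The points are the multiples 0, 1, ..., n of \<open>\<one>\<close>. Their
    differences are, up to sign, the multiples by l - k, which lies between 1 and
    \<open>n\<close>.\<close>
  have "nonzerodivisor R ([k] \<cdot> \<one> \<ominus> [l] \<cdot> \<one>)" if "k < l" "l \<le> n" for k l
  proof -
    have c: "[k] \<cdot> \<one> \<in> carrier R" "[(l - k)] \<cdot> \<one> \<in> carrier R" by simp_all
    have "[l] \<cdot> \<one> = [k] \<cdot> \<one> \<oplus> [(l - k)] \<cdot> \<one>"
      using that add.nat_pow_mult[of \<one> k "l - k"] by simp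
    then have "[k] \<cdot> \<one> \<ominus> [l] \<cdot> \<one> = \<ominus> ([(l - k)] \<cdot> \<one>)"
      using c by algebra
    then show ?thesis
      using nonzerodivisor_uminus assms that by simp
  qed
  then show ?thesis
    by (intro exI[of _ "\<lambda>k. [k] \<cdot> \<one>"]) simp
qed

end

lemma (in domain) ex_nonzerodivisor_differences_domain:
  assumes "infinite (carrier R) \<or> n < card (carrier R)"
  shows "\<exists>x. (\<forall>k\<le>n. x k \<in> carrier R) \<and>
    (\<forall>k l. k < l \<longrightarrow> l \<le> (n::nat) \<longrightarrow> nonzerodivisor R (x k \<ominus> x l))"
proof -
  \<comment> \<open>In a domain any distinct points will do. The indices 0 to \<open>n\<close>
    require \<open>Suc n\<close> of them, which is what the strict bound on \<open>n\<close>
    provides.\<close>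
  obtain X where X: "X \<subseteq> carrier R" "card X = Suc n" "finite X"
    using assms infinite_arbitrarily_large[of "carrier R" "Suc n"]
      obtain_subset_with_card_n[of "Suc n" "carrier R"] by (metis Suc_leI)
  obtain x where x: "bij_betw x {0..<Suc n} X"
    using ex_bij_betw_nat_finite[OF X(3)] X(2) by auto
  then have xc: "x k \<in> carrier R" if "k \<le> n" for k
    using X(1) that by (force simp: bij_betw_def)
  have "x k \<noteq> x l" if "k < l" "l \<le> n" for k l
    using x that by (auto simp: bij_betw_def dest: inj_onD)
  then have "nonzerodivisor R (x k \<ominus> x l)" if "k < l" "l \<le> n" for k l
    using xc that by (auto simp: nonzerodivisor_def integral_iff)
  then show ?thesis using xc by blast
qed

section \<open>Multilinear functions\<close>

lemma (in cring) multilinear_eq_finprod: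
  assumes "finite S"
    and "\<And>x i. \<lbrakk>x \<in> U \<rightarrow> carrier R; i \<in> S\<rbrakk> \<Longrightarrow> g x = x i \<otimes> g (x(i := \<one>))"
    and "x \<in> U \<rightarrow> carrier R" and "S \<subseteq> U"
    and "\<And>x. x \<in> U \<rightarrow> carrier R \<Longrightarrow> g x \<in> carrier R"
  shows "g x = (\<Otimes>j\<in>S. x j) \<otimes> g (\<lambda>j. if j \<in> S then \<one> else x j)"
  using assms
\<comment> \<open>The coordinates in \<open>S\<close> are pulled out one at a time. \<open>U\<close>
  stays fixed while \<open>S\<close> shrinks, so the closure conditions on \<open>g\<close> and its
  arguments are the same at every stage.\<close>
proof (induction S arbitrary: x)
  case empty
  then show ?case by simp
next
  case (insert i S)
  \<comment> \<open>At \<open>?y\<close> the coordinates in \<open>S\<close> have already been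
    replaced by \<open>\<one>\<close>, while coordinate \<open>i\<close> still has its original
    value.\<close>
  let ?y = "\<lambda>j. if j \<in> S then \<one> else x j"
  have y: "?y \<in> U \<rightarrow> carrier R" and xS: "x \<in> S \<rightarrow> carrier R" "x i \<in> carrier R"
    using insert.prems by auto
  have "?y(i := \<one>) = (\<lambda>j. if j \<in> insert i S then \<one> else x j)" (is "_ = ?z")
    by auto
  moreover have "g ?y = ?y i \<otimes> g (?y(i := \<one>))"
    using insert.prems(1) y by blast
  moreover have "?y i = x i"
    using insert.hyps by simp
  moreover have "g x = (\<Otimes>j\<in>S. x j) \<otimes> g ?y"
    using insert.prems by (intro insert.IH) auto
  moreover have "?z \<in> U \<rightarrow> carrier R"
    using insert.prems by auto
  ultimately show ?case
    using insert.hyps xS insert.prems(4) by (simp add: finprod_insert m_ac)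
qed

section \<open>Lines and the remainder on finitely many coordinates\<close>

context module
begin

lemma finsum_smult_insert:
  assumes "finite S" "i \<notin> S" "e \<in> insert i S \<rightarrow> carrier M" "a \<in> insert i S \<rightarrow> carrier R"
  shows "(\<Oplus>\<^bsub>M\<^esub>j\<in>insert i S. a j \<odot>\<^bsub>M\<^esub> e j)
    = (\<Oplus>\<^bsub>M\<^esub>j\<in>S. a j \<odot>\<^bsub>M\<^esub> e j) \<oplus>\<^bsub>M\<^esub> a i \<odot>\<^bsub>M\<^esub> e i"
proof -
  have "(\<lambda>j. a j \<odot>\<^bsub>M\<^esub> e j) \<in> S \<rightarrow> carrier M" "a i \<odot>\<^bsub>M\<^esub> e i \<in> carrier M"
    using assms by auto
  then show ?thesis
    using assms by (simp add: M.finsum_insert M.a_comm)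
qed

lemma affine_on_lineD:
  assumes "affine_linear_on R M p (cyclic_submodule R M v) f"
    and "p \<in> carrier M" "v \<in> carrier M" "r \<in> carrier R"
  shows "f (p \<oplus>\<^bsub>M\<^esub> r \<odot>\<^bsub>M\<^esub> v) \<ominus> f p = r \<otimes> (f (p \<oplus>\<^bsub>M\<^esub> v) \<ominus> f p)"
proof -
  have 0: "\<zero>\<^bsub>M\<^esub> \<in> cyclic_submodule R M v" and 1: "v \<in> cyclic_submodule R M v"
    using assms(3) unfolding cyclic_submodule_def
    by (auto intro: exI[of _ "\<zero>"] exI[of _ "\<one>"])
  have "p \<in> p <+\<^bsub>M\<^esub> cyclic_submodule R M v"
    using 0 assms(2) by (force simp: a_l_coset_def')
  then have "linear_form_on R M (cyclic_submodule R M v) (\<lambda>n. f (n \<oplus>\<^bsub>M\<^esub> p) \<ominus> f p)"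
    using assms(1) by (auto simp: affine_linear_on_def)
  then have "f (r \<odot>\<^bsub>M\<^esub> v \<oplus>\<^bsub>M\<^esub> p) \<ominus> f p = r \<otimes> (f (v \<oplus>\<^bsub>M\<^esub> p) \<ominus> f p)"
    using 1 assms(4) by (auto simp: linear_form_on_def)
  then show ?thesis
    using assms(2-4) by (simp add: M.a_comm)
qed

text \<open>The induction step for one \<open>S\<close>. \<open>line\<close> makes the remainder
  affine in each coordinate, \<open>IH\<close> makes it vanish with any coordinate,
  \<open>diag\<close> is linearity along the line spanned by the fixed vector of \<open>S\<close>,
  and \<open>y\<close> lists the points for \<open>eq_zero_of_pow_mult_eq\<close>.\<close>

lemma linear_on_combinations_of_proper_subsets:
  assumes S: "finite S" "card S \<ge> 2"
    and e: "e \<in> S \<rightarrow> carrier M"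
    and h: "h \<in> carrier M \<rightarrow> carrier R"
    and line: "\<And>p r i. \<lbrakk>p \<in> carrier M; r \<in> carrier R; i \<in> S\<rbrakk> \<Longrightarrow>
      h (p \<oplus>\<^bsub>M\<^esub> r \<odot>\<^bsub>M\<^esub> e i) = h p \<oplus> r \<otimes> (h (p \<oplus>\<^bsub>M\<^esub> e i) \<ominus> h p)"
    and IH: "\<And>i x. \<lbrakk>i \<in> S; x \<in> S - {i} \<rightarrow> carrier R\<rbrakk> \<Longrightarrow>
      h (\<Oplus>\<^bsub>M\<^esub>j\<in>S - {i}. x j \<odot>\<^bsub>M\<^esub> e j) = (\<Oplus>j\<in>S - {i}. x j \<otimes> h (e j))"
    and c: "\<And>j. j \<in> S \<Longrightarrow> nonzerodivisor R (c j)"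
    and diag: "\<And>r. r \<in> carrier R \<Longrightarrow>
      h (r \<odot>\<^bsub>M\<^esub> (\<Oplus>\<^bsub>M\<^esub>j\<in>S. c j \<odot>\<^bsub>M\<^esub> e j)) = r \<otimes> h (\<Oplus>\<^bsub>M\<^esub>j\<in>S. c j \<odot>\<^bsub>M\<^esub> e j)"
    and y: "\<And>k. k \<le> card S \<Longrightarrow> y k \<in> carrier R"
      "\<And>k l. k < l \<Longrightarrow> l \<le> card S \<Longrightarrow> nonzerodivisor R (y k \<ominus> y l)"
    and x: "x \<in> S \<rightarrow> carrier R"
  shows "h (\<Oplus>\<^bsub>M\<^esub>j\<in>S. x j \<odot>\<^bsub>M\<^esub> e j) = (\<Oplus>j\<in>S. x j \<otimes> h (e j))"
proof -
  have he: "h (e j) \<in> carrier R" if "j \<in> S" for j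
    using that e h by auto
  define L where "L = (\<lambda>x. \<Oplus>\<^bsub>M\<^esub>j\<in>S. x j \<odot>\<^bsub>M\<^esub> e j)"
  define l where "l = (\<lambda>x. \<Oplus>j\<in>S. x j \<otimes> h (e j))"
  define g where "g = (\<lambda>x. h (L x) \<ominus> l x)"
  have L: "L x \<in> carrier M" if "x \<in> S \<rightarrow> carrier R" for x
    unfolding L_def using that e by (intro M.finsum_closed) auto
  have l: "l x \<in> carrier R" if "x \<in> S \<rightarrow> carrier R" for x
    unfolding l_def using that he by (intro R.finsum_closed) auto
  have gc: "g x \<in> carrier R" if "x \<in> S \<rightarrow> carrier R" for x
    unfolding g_def using funcset_mem[OF h L[OF that]] l[OF that] by simp
  \<comment> \<open>With coordinate \<open>i\<close> set to zero the vector is \<open>?p\<close>,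
    where \<open>IH\<close> gives \<open>h ?p = ?s\<close>, so the affine dependence on
    \<open>x i\<close> has no constant term. Its slope is the value at
    \<open>x i = \<one>\<close>.\<close>
  have step: "g x = x i \<otimes> g (x(i := \<one>))" if x: "x \<in> S \<rightarrow> carrier R" and i: "i \<in> S" for x i
  proof -
    let ?p = "\<Oplus>\<^bsub>M\<^esub>j\<in>S - {i}. x j \<odot>\<^bsub>M\<^esub> e j" and ?s = "\<Oplus>j\<in>S - {i}. x j \<otimes> h (e j)"
    have ins: "insert i (S - {i}) = S"
      using i by auto
    have hp: "h ?p = ?s"
      using x by (intro IH[OF i]) auto
    have p: "?p \<in> carrier M" and s: "?s \<in> carrier R"
      using x e he by (auto intro!: M.finsum_closed R.finsum_closed)
    \<comment> \<open>Stated for \<open>z\<close> because it is applied both to \<open>x\<close> and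
      to \<open>x(i := \<one>)\<close>, which share \<open>?p\<close> and \<open>?s\<close>.\<close>
    have decomp: "L z = ?p \<oplus>\<^bsub>M\<^esub> z i \<odot>\<^bsub>M\<^esub> e i" "l z = ?s \<oplus> z i \<otimes> h (e i)"
      if z: "z \<in> S \<rightarrow> carrier R" "\<And>j. j \<in> S - {i} \<Longrightarrow> z j = x j" for z
    proof -
      have "(\<Oplus>\<^bsub>M\<^esub>j\<in>S - {i}. z j \<odot>\<^bsub>M\<^esub> e j) = ?p"
        using z x e by (intro M.finsum_cong') auto
      then show "L z = ?p \<oplus>\<^bsub>M\<^esub> z i \<odot>\<^bsub>M\<^esub> e i"
        using finsum_smult_insert[of "S - {i}" i e z] S(1) e z(1) unfolding L_def ins by simp
      have "(\<Oplus>j\<in>S - {i}. z j \<otimes> h (e j)) = ?s"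
        using z x he by (intro R.finsum_cong') auto
      then show "l z = ?s \<oplus> z i \<otimes> h (e i)"
        using R.finsum_insert[of "S - {i}" i "\<lambda>j. z j \<otimes> h (e j)"] S(1) he z(1) i s
        unfolding l_def ins by (simp add: Pi_iff R.a_comm)
    qed
    have xi: "x i \<in> carrier R" and ei: "e i \<in> carrier M"
      using x e i by auto
    have q: "h (?p \<oplus>\<^bsub>M\<^esub> e i) \<in> carrier R"
      using h p ei by auto
    have "g x = ?s \<oplus> x i \<otimes> (h (?p \<oplus>\<^bsub>M\<^esub> e i) \<ominus> ?s) \<ominus> (?s \<oplus> x i \<otimes> h (e i))"
      unfolding g_def using decomp[OF x] line[OF p xi i] hp by simp
    also have "\<dots> = x i \<otimes> (h (?p \<oplus>\<^bsub>M\<^esub> e i) \<ominus> (?s \<oplus> h (e i)))"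
      by (rule R.affine_remainder_eq[OF s xi q he[OF i]])
    also have "h (?p \<oplus>\<^bsub>M\<^esub> e i) \<ominus> (?s \<oplus> h (e i)) = g (x(i := \<one>))"
      unfolding g_def using decomp[of "x(i := \<one>)"] x ei he[OF i] by (simp add: Pi_iff)
    finally show ?thesis .
  qed
  define b where "b = g (\<lambda>_. \<one>)"
  have b: "b \<in> carrier R"
    unfolding b_def by (rule gc) simp
  \<comment> \<open>The vector of ones produced by \<open>multilinear_eq_finprod\<close> agrees with
    the constant \<open>\<one>\<close> only on \<open>S\<close>, but \<open>g\<close> sees no other
    coordinates.\<close>
  have gcong: "g z = g w" if "\<And>j. j \<in> S \<Longrightarrow> z j = w j" "w \<in> S \<rightarrow> carrier R" for z w
  proof -
    have "L z = L w" unfolding L_def using that e by (intro M.finsum_cong') auto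
    moreover have "l z = l w" unfolding l_def using that he by (intro R.finsum_cong') auto
    ultimately show ?thesis by (simp add: g_def)
  qed
  have gprod: "g z = (\<Otimes>j\<in>S. z j) \<otimes> b" if z: "z \<in> S \<rightarrow> carrier R" for z
  proof -
    have "g z = (\<Otimes>j\<in>S. z j) \<otimes> g (\<lambda>j. if j \<in> S then \<one> else z j)"
      by (rule R.multilinear_eq_finprod[OF S(1) step z subset_refl gc])
    also have "g (\<lambda>j. if j \<in> S then \<one> else z j) = b"
      unfolding b_def by (rule gcong) auto
    finally show ?thesis .
  qed
  have cc: "c \<in> S \<rightarrow> carrier R"
    using nonzerodivisor_closed[OF c] by (rule Pi_I)
  \<comment> \<open>The value of \<open>g\<close> at the scaled coefficients is computed twice:
    linearity along the diagonal line gives r g(c), and the product formula gives r^n g(c) with n =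
    \<open>card S\<close>.\<close>
  have "r [^] card S \<otimes> g c = r \<otimes> g c" if r: "r \<in> carrier R" for r
  proof -
    have rc: "(\<lambda>j. r \<otimes> c j) \<in> S \<rightarrow> carrier R"
      using r cc by auto
    have 1: "L (\<lambda>j. r \<otimes> c j) = r \<odot>\<^bsub>M\<^esub> L c"
    proof -
      have "r \<odot>\<^bsub>M\<^esub> L c = (\<Oplus>\<^bsub>M\<^esub>j\<in>S. r \<odot>\<^bsub>M\<^esub> (c j \<odot>\<^bsub>M\<^esub> e j))"
        unfolding L_def using S(1) r cc e by (intro finsum_smult_ldistr) auto
      also have "\<dots> = L (\<lambda>j. r \<otimes> c j)"
        unfolding L_def using r cc e by (intro M.finsum_cong') (auto simp: smult_assoc1 Pi_iff)
      finally show ?thesis by simp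
    qed
    have 2: "l (\<lambda>j. r \<otimes> c j) = r \<otimes> l c"
    proof -
      have "r \<otimes> l c = (\<Oplus>j\<in>S. r \<otimes> (c j \<otimes> h (e j)))"
        unfolding l_def using S(1) r cc he by (intro R.finsum_rdistr) auto
      also have "\<dots> = l (\<lambda>j. r \<otimes> c j)"
        unfolding l_def using r cc he by (intro R.finsum_cong') (auto simp: R.m_assoc Pi_iff)
      finally show ?thesis by simp
    qed
    have diagL: "h (r \<odot>\<^bsub>M\<^esub> L c) = r \<otimes> h (L c)"
      unfolding L_def using diag[OF r] .
    have "h (L c) \<in> carrier R" "l c \<in> carrier R"
      using h L[OF cc] l[OF cc] by auto
    then have "g (\<lambda>j. r \<otimes> c j) = r \<otimes> g c"
      unfolding g_def 1 2 diagL using r by (simp add: R.mult_diff_distrib)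
    moreover have "(\<Otimes>j\<in>S. r \<otimes> c j) = r [^] card S \<otimes> (\<Otimes>j\<in>S. c j)"
      using R.finprod_multf[of "\<lambda>_. r" S c] R.finprod_const[of r S] r cc by simp
    ultimately show ?thesis
      using gprod[OF rc] gprod[OF cc] r b cc by (simp add: R.m_assoc)
  qed
  then have "g c = \<zero>"
    using R.eq_zero_of_pow_mult_eq[OF gc[OF cc] S(2)] y by blast
  \<comment> \<open>By \<open>gprod\<close>, \<open>g c\<close> is \<open>b\<close> times the
    product of the \<open>c j\<close>, and that product can be cancelled.\<close>
  then have "b = \<zero>"
    using nonzerodivisorD[OF R.nonzerodivisor_finprod[OF S(1) c] b] gprod[OF cc] by simp
  then have "g x = \<zero>"
    using gprod[OF x] x by simp
  then have "h (L x) = l x"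
    unfolding g_def using R.r_right_minus_eq[OF funcset_mem[OF h L[OF x]] l[OF x]] by simp
  then show ?thesis
    unfolding L_def l_def .
qed

section \<open>Linearity from finite supports to the whole module\<close>

lemma finsum_smult_extend:
  assumes "finite K" "J \<subseteq> K" "e \<in> K \<rightarrow> carrier M" "a \<in> J \<rightarrow> carrier R"
  shows "(\<Oplus>\<^bsub>M\<^esub>j\<in>K. (if j \<in> J then a j else \<zero>) \<odot>\<^bsub>M\<^esub> e j)
    = (\<Oplus>\<^bsub>M\<^esub>j\<in>J. a j \<odot>\<^bsub>M\<^esub> e j)"
  by (rule M.add.finprod_mono_neutral_cong_right) (use assms in \<open>auto simp: Pi_iff subset_iff\<close>)

text \<open>Padding both combinations with zero coefficients up to the union of their supports makes
  coordinatewise addition possible.\<close>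

lemma spanning_set_common_support:
  assumes e: "e \<in> I \<rightarrow> carrier M"
    and span: "\<And>v. v \<in> carrier M \<Longrightarrow> \<exists>J a. finite J \<and> J \<subseteq> I \<and> a \<in> J \<rightarrow> carrier R \<and>
      v = (\<Oplus>\<^bsub>M\<^esub>j\<in>J. a j \<odot>\<^bsub>M\<^esub> e j)"
    and v: "v \<in> carrier M" and w: "w \<in> carrier M"
  obtains S a b where "finite S" "S \<subseteq> I" "a \<in> S \<rightarrow> carrier R" "b \<in> S \<rightarrow> carrier R"
    "v = (\<Oplus>\<^bsub>M\<^esub>j\<in>S. a j \<odot>\<^bsub>M\<^esub> e j)" "w = (\<Oplus>\<^bsub>M\<^esub>j\<in>S. b j \<odot>\<^bsub>M\<^esub> e j)"
proof -
  obtain J a where J: "finite J" "J \<subseteq> I" "a \<in> J \<rightarrow> carrier R"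
      "v = (\<Oplus>\<^bsub>M\<^esub>j\<in>J. a j \<odot>\<^bsub>M\<^esub> e j)"
    using span[OF v] by blast
  obtain K b where K: "finite K" "K \<subseteq> I" "b \<in> K \<rightarrow> carrier R"
      "w = (\<Oplus>\<^bsub>M\<^esub>j\<in>K. b j \<odot>\<^bsub>M\<^esub> e j)"
    using span[OF w] by blast
  have e': "e \<in> J \<union> K \<rightarrow> carrier M"
    using e J(2) K(2) by auto
  show thesis
  proof (rule that)
    show "v = (\<Oplus>\<^bsub>M\<^esub>j\<in>J \<union> K. (if j \<in> J then a j else \<zero>) \<odot>\<^bsub>M\<^esub> e j)"
      using finsum_smult_extend[of "J \<union> K" J e a] J K e' by simp
    show "w = (\<Oplus>\<^bsub>M\<^esub>j\<in>J \<union> K. (if j \<in> K then b j else \<zero>) \<odot>\<^bsub>M\<^esub> e j)"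
      using finsum_smult_extend[of "J \<union> K" K e b] J K e' by simp
  qed (use J K in auto)
qed

lemma linear_form_on_carrierI:
  assumes e: "e \<in> I \<rightarrow> carrier M"
    and span: "\<And>v. v \<in> carrier M \<Longrightarrow> \<exists>J a. finite J \<and> J \<subseteq> I \<and> a \<in> J \<rightarrow> carrier R \<and>
      v = (\<Oplus>\<^bsub>M\<^esub>j\<in>J. a j \<odot>\<^bsub>M\<^esub> e j)"
    and h: "h \<in> carrier M \<rightarrow> carrier R"
    and lin: "\<And>S x. \<lbrakk>finite S; S \<subseteq> I; x \<in> S \<rightarrow> carrier R\<rbrakk> \<Longrightarrow>
      h (\<Oplus>\<^bsub>M\<^esub>j\<in>S. x j \<odot>\<^bsub>M\<^esub> e j) = (\<Oplus>j\<in>S. x j \<otimes> h (e j))"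
  shows "linear_form_on R M (carrier M) h"
  unfolding linear_form_on_def
proof (intro conjI ballI)
  fix v w assume vw: "v \<in> carrier M" "w \<in> carrier M"
  obtain S a b where S: "finite S" "S \<subseteq> I" and a: "a \<in> S \<rightarrow> carrier R" and b: "b \<in> S \<rightarrow> carrier R"
    and v: "v = (\<Oplus>\<^bsub>M\<^esub>j\<in>S. a j \<odot>\<^bsub>M\<^esub> e j)" and w: "w = (\<Oplus>\<^bsub>M\<^esub>j\<in>S. b j \<odot>\<^bsub>M\<^esub> e j)"
    using e span vw by (rule spanning_set_common_support)
  have eS: "e j \<in> carrier M" "h (e j) \<in> carrier R" if "j \<in> S" for j
    using e h S(2) that by auto
  have "v \<oplus>\<^bsub>M\<^esub> w = (\<Oplus>\<^bsub>M\<^esub>j\<in>S. a j \<odot>\<^bsub>M\<^esub> e j \<oplus>\<^bsub>M\<^esub> b j \<odot>\<^bsub>M\<^esub> e j)"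
    unfolding v w using a b eS by (intro M.finsum_addf[symmetric]) auto
  also have "\<dots> = (\<Oplus>\<^bsub>M\<^esub>j\<in>S. (a j \<oplus> b j) \<odot>\<^bsub>M\<^esub> e j)"
    using a b eS by (intro M.finsum_cong') (auto simp: smult_l_distr Pi_iff)
  finally have "h (v \<oplus>\<^bsub>M\<^esub> w) = (\<Oplus>j\<in>S. (a j \<oplus> b j) \<otimes> h (e j))"
    using lin[OF S, of "\<lambda>j. a j \<oplus> b j"] a b by (simp add: Pi_iff)
  also have "\<dots> = (\<Oplus>j\<in>S. a j \<otimes> h (e j) \<oplus> b j \<otimes> h (e j))"
    using a b eS by (intro R.finsum_cong') (auto simp: R.l_distr Pi_iff)
  also have "\<dots> = h v \<oplus> h w"
    unfolding v w lin[OF S a] lin[OF S b] using a b eS by (intro R.finsum_addf) auto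
  finally show "h (v \<oplus>\<^bsub>M\<^esub> w) = h v \<oplus> h w" .
next
  fix r v assume r: "r \<in> carrier R" and "v \<in> carrier M"
  then obtain S a where S: "finite S" "S \<subseteq> I" and a: "a \<in> S \<rightarrow> carrier R"
    and v: "v = (\<Oplus>\<^bsub>M\<^esub>j\<in>S. a j \<odot>\<^bsub>M\<^esub> e j)"
    using span by blast
  have eS: "e j \<in> carrier M" "h (e j) \<in> carrier R" if "j \<in> S" for j
    using e h S(2) that by auto
  have "r \<odot>\<^bsub>M\<^esub> v = (\<Oplus>\<^bsub>M\<^esub>j\<in>S. r \<odot>\<^bsub>M\<^esub> (a j \<odot>\<^bsub>M\<^esub> e j))"
    unfolding v using S(1) r a eS by (intro finsum_smult_ldistr) auto
  also have "\<dots> = (\<Oplus>\<^bsub>M\<^esub>j\<in>S. (r \<otimes> a j) \<odot>\<^bsub>M\<^esub> e j)"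
    using r a eS by (intro M.finsum_cong') (auto simp: smult_assoc1 Pi_iff)
  finally have "h (r \<odot>\<^bsub>M\<^esub> v) = (\<Oplus>j\<in>S. (r \<otimes> a j) \<otimes> h (e j))"
    using lin[OF S, of "\<lambda>j. r \<otimes> a j"] a r by (simp add: Pi_iff)
  also have "\<dots> = (\<Oplus>j\<in>S. r \<otimes> (a j \<otimes> h (e j)))"
    using r a eS by (intro R.finsum_cong') (auto simp: R.m_assoc Pi_iff)
  also have "\<dots> = r \<otimes> h v"
    unfolding v lin[OF S a] using S(1) r a eS by (intro R.finsum_rdistr[symmetric]) auto
  finally show "h (r \<odot>\<^bsub>M\<^esub> v) = r \<otimes> h v" .
qed (fact h)

text \<open>By additivity of the normalised map, the increment of \<open>f\<close> from any base
  point \<open>q\<close> equals its increment from the origin, so one linear form serves all base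
  points.\<close>

lemma affine_linear_on_carrierI:
  assumes "linear_form_on R M (carrier M) (\<lambda>v. f v \<ominus> f \<zero>\<^bsub>M\<^esub>)" and f: "f \<in> carrier M \<rightarrow> carrier R"
    and p: "p \<in> carrier M"
  shows "affine_linear_on R M p (carrier M) f"
proof -
  have "linear_form_on R M (carrier M) (\<lambda>n. f (n \<oplus>\<^bsub>M\<^esub> q) \<ominus> f q)" if q: "q \<in> carrier M" for q
  proof -
    have "f (n \<oplus>\<^bsub>M\<^esub> q) \<ominus> f q = f n \<ominus> f \<zero>\<^bsub>M\<^esub>" if n: "n \<in> carrier M" for n
    proof -
      have c: "f (n \<oplus>\<^bsub>M\<^esub> q) \<in> carrier R" "f n \<in> carrier R" "f q \<in> carrier R" "f \<zero>\<^bsub>M\<^esub> \<in> carrier R"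
        using f n q by auto
      have "f (n \<oplus>\<^bsub>M\<^esub> q) \<ominus> f \<zero>\<^bsub>M\<^esub> = (f n \<ominus> f \<zero>\<^bsub>M\<^esub>) \<oplus> (f q \<ominus> f \<zero>\<^bsub>M\<^esub>)"
        using assms(1) n q by (simp add: linear_form_on_def)
      then show ?thesis
        by (rule R.diff_eq_diff_of_diff_eq_add[OF c])
    qed
    then show ?thesis
      using assms(1) unfolding linear_form_on_def Pi_iff by simp
  qed
  moreover have "q \<in> carrier M" if "q \<in> p <+\<^bsub>M\<^esub> carrier M" for q
    using that p by (auto simp: a_l_coset_def')
  ultimately show ?thesis
    unfolding affine_linear_on_def by blast
qed

end

section \<open>Induction over finite supports\<close>

theorem theorem1p3:
  fixes R :: "('r, 'x) ring_scheme"
    and M :: "('r, 'm, 'y) module_scheme"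
    and I :: "'i set"
    and e :: "'i \<Rightarrow> 'm"
    and c :: "'i set \<Rightarrow> 'i \<Rightarrow> 'r"
    and m :: "'i set \<Rightarrow> 'm"
    and f :: "'m \<Rightarrow> 'r"
  assumes "cring R"
    and "module R M"
    and "is_basis R M I e"
    and "(\<forall>n::nat. 1 \<le> n \<and> (finite I \<longrightarrow> n \<le> card I) \<longrightarrow> nonzerodivisor R ([n] \<cdot>\<^bsub>R\<^esub> \<one>\<^bsub>R\<^esub>)) \<or>
      (domain R \<and>
        (infinite (carrier R) \<or>
         finite (carrier R) \<and> finite I \<and> card I < card (carrier R)))"
    and "\<And>J j. finite J \<Longrightarrow> J \<subseteq> I \<Longrightarrow> j \<in> J \<Longrightarrow> nonzerodivisor R (c J j)"
    and "\<And>J. finite J \<Longrightarrow> J \<subseteq> I \<Longrightarrow> m J = (\<Oplus>\<^bsub>M\<^esub>j\<in>J. c J j \<odot>\<^bsub>M\<^esub> e j)"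
    and "f \<in> carrier M \<rightarrow> carrier R"
    and "\<And>m\<^sub>0 i. m\<^sub>0 \<in> carrier M \<Longrightarrow> i \<in> I \<Longrightarrow>
      affine_linear_on R M m\<^sub>0 (cyclic_submodule R M (e i)) f"
    and "\<And>J. finite J \<Longrightarrow> J \<subseteq> I \<Longrightarrow> card J \<ge> 2 \<Longrightarrow>
      affine_linear_on R M \<zero>\<^bsub>M\<^esub> (cyclic_submodule R M (m J)) f"
  shows "affine_linear_on R M \<zero>\<^bsub>M\<^esub> (carrier M) f"
proof -
  interpret module R M by fact
  have e: "e \<in> I \<rightarrow> carrier M"
    and span: "\<And>v. v \<in> carrier M \<Longrightarrow> \<exists>J a. finite J \<and> J \<subseteq> I \<and> a \<in> J \<rightarrow> carrier R \<and>
      v = (\<Oplus>\<^bsub>M\<^esub>j\<in>J. a j \<odot>\<^bsub>M\<^esub> e j)"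
    using assms(3) by (simp_all add: is_basis_def)
  note f = assms(7)
  define h where "h = (\<lambda>v. f v \<ominus>\<^bsub>R\<^esub> f \<zero>\<^bsub>M\<^esub>)"
  have h: "h \<in> carrier M \<rightarrow> carrier R"
    using f by (auto simp: h_def)
  have h0: "h \<zero>\<^bsub>M\<^esub> = \<zero>\<^bsub>R\<^esub>"
    unfolding h_def using funcset_mem[OF f M.zero_closed] by simp
  have h_line: "h (p \<oplus>\<^bsub>M\<^esub> r \<odot>\<^bsub>M\<^esub> v) = h p \<oplus>\<^bsub>R\<^esub> r \<otimes>\<^bsub>R\<^esub> (h (p \<oplus>\<^bsub>M\<^esub> v) \<ominus>\<^bsub>R\<^esub> h p)"
    if "affine_linear_on R M p (cyclic_submodule R M v) f"
      and p: "p \<in> carrier M" and v: "v \<in> carrier M" and r: "r \<in> carrier R" for p v r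
  proof -
    have "f (p \<oplus>\<^bsub>M\<^esub> r \<odot>\<^bsub>M\<^esub> v) \<ominus>\<^bsub>R\<^esub> f p = r \<otimes>\<^bsub>R\<^esub> (f (p \<oplus>\<^bsub>M\<^esub> v) \<ominus>\<^bsub>R\<^esub> f p)"
      using that by (rule affine_on_lineD)
    moreover have "f (p \<oplus>\<^bsub>M\<^esub> r \<odot>\<^bsub>M\<^esub> v) \<in> carrier R" "f (p \<oplus>\<^bsub>M\<^esub> v) \<in> carrier R"
        "f p \<in> carrier R" "f \<zero>\<^bsub>M\<^esub> \<in> carrier R"
      using f p v r by auto
    ultimately show ?thesis
      unfolding h_def by (intro R.diff_eq_add_mult_diff_shift)
  qed
  \<comment> \<open>This is \<open>h_line\<close> at the origin, where \<open>h\<close> vanishes; it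
    covers the axes as well as the lines spanned by the \<open>m J\<close>.\<close>
  have h_ray: "h (r \<odot>\<^bsub>M\<^esub> v) = r \<otimes>\<^bsub>R\<^esub> h v"
    if "affine_linear_on R M \<zero>\<^bsub>M\<^esub> (cyclic_submodule R M v) f" "v \<in> carrier M" "r \<in> carrier R" for v r
    using h_line[OF that(1) _ that(2,3)] h that(2,3) by (simp add: h0 R.minus_eq Pi_iff)
  have points: "\<exists>y. (\<forall>k\<le>card S. y k \<in> carrier R) \<and>
      (\<forall>k l. k < l \<longrightarrow> l \<le> card S \<longrightarrow> nonzerodivisor R (y k \<ominus>\<^bsub>R\<^esub> y l))"
    if "finite S" "S \<subseteq> I" for S
  proof -
    \<comment> \<open>Conditional because \<open>card\<close> of an infinite set is
      \<open>0\<close>; for infinite \<open>I\<close>, (A) covers every positive integer and (B)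
      forces \<open>R\<close> to be infinite.\<close>
    have le: "card S \<le> card I" if "finite I"
      using \<open>S \<subseteq> I\<close> that by (rule card_mono[rotated])
    from assms(4) show ?thesis
    proof
      assume "\<forall>n::nat. 1 \<le> n \<and> (finite I \<longrightarrow> n \<le> card I) \<longrightarrow> nonzerodivisor R ([n] \<cdot>\<^bsub>R\<^esub> \<one>\<^bsub>R\<^esub>)"
      then show ?thesis
        using le by (intro R.ex_nonzerodivisor_differences_char) (meson le_trans)
    next
      assume B: "domain R \<and> (infinite (carrier R) \<or>
        finite (carrier R) \<and> finite I \<and> card I < card (carrier R))"
      then interpret domain R by simp
      show ?thesis
        using B le by (intro ex_nonzerodivisor_differences_domain) auto
    qed
  qed
  have "h (\<Oplus>\<^bsub>M\<^esub>j\<in>S. x j \<odot>\<^bsub>M\<^esub> e j) = (\<Oplus>\<^bsub>R\<^esub>j\<in>S. x j \<otimes>\<^bsub>R\<^esub> h (e j))"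
    if "finite S" "S \<subseteq> I" "x \<in> S \<rightarrow> carrier R" for S x
    using that
  proof (induction S arbitrary: x rule: finite_psubset_induct)
    case (psubset S)
    have eS: "e \<in> S \<rightarrow> carrier M"
      using e psubset.prems(1) by auto
    \<comment> \<open>A singleton is settled by its axis through the origin. The diagonal lines are
      given only from two indices on, which is also where r^n d = r d starts to carry
      information.\<close>
    consider "S = {}" | i where "S = {i}" | "card S \<ge> 2"
      using psubset.hyps by (metis One_nat_def card_1_singletonE card_eq_0_iff less_2_cases not_le)
    then show ?case
    proof cases
      case 1
      then show ?thesis by (simp add: h0)
    next
      case (2 i)
      then have i: "i \<in> I" "e i \<in> carrier M" "x i \<in> carrier R" "h (e i) \<in> carrier R"
        using eS psubset.prems h by auto
      then show ?thesis
        using h_ray[OF assms(8)[OF _ i(1)] i(2,3)] by (simp add: 2)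
    next
      case 3
      obtain y where y: "\<And>k. k \<le> card S \<Longrightarrow> y k \<in> carrier R"
          "\<And>k l. k < l \<Longrightarrow> l \<le> card S \<Longrightarrow> nonzerodivisor R (y k \<ominus>\<^bsub>R\<^esub> y l)"
        using points[OF psubset.hyps psubset.prems(1)] by blast
      have c: "nonzerodivisor R (c S j)" if "j \<in> S" for j
        using assms(5)[OF psubset.hyps psubset.prems(1) that] .
      have m: "m S = (\<Oplus>\<^bsub>M\<^esub>j\<in>S. c S j \<odot>\<^bsub>M\<^esub> e j)"
        using assms(6)[OF psubset.hyps psubset.prems(1)] .
      have mS: "m S \<in> carrier M"
        unfolding m using nonzerodivisor_closed[OF c] eS by (intro M.finsum_closed) (auto simp: Pi_iff)
      show ?thesis
      proof (rule linear_on_combinations_of_proper_subsets[OF psubset.hyps 3 eS h _ _ c _ y psubset.prems(2)])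
        fix p r i assume p: "p \<in> carrier M" and r: "r \<in> carrier R" and i: "i \<in> S"
        have i': "i \<in> I" "e i \<in> carrier M"
          using i eS psubset.prems(1) by auto
        show "h (p \<oplus>\<^bsub>M\<^esub> r \<odot>\<^bsub>M\<^esub> e i) = h p \<oplus>\<^bsub>R\<^esub> r \<otimes>\<^bsub>R\<^esub> (h (p \<oplus>\<^bsub>M\<^esub> e i) \<ominus>\<^bsub>R\<^esub> h p)"
          by (rule h_line[OF assms(8)[OF p i'(1)] p i'(2) r])
      next
        fix i x assume "i \<in> S" "x \<in> S - {i} \<rightarrow> carrier R"
        then show "h (\<Oplus>\<^bsub>M\<^esub>j\<in>S - {i}. x j \<odot>\<^bsub>M\<^esub> e j) = (\<Oplus>\<^bsub>R\<^esub>j\<in>S - {i}. x j \<otimes>\<^bsub>R\<^esub> h (e j))"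
          using psubset.prems(1) by (intro psubset.IH) auto
      next
        fix r assume "r \<in> carrier R"
        then show "h (r \<odot>\<^bsub>M\<^esub> (\<Oplus>\<^bsub>M\<^esub>j\<in>S. c S j \<odot>\<^bsub>M\<^esub> e j))
            = r \<otimes>\<^bsub>R\<^esub> h (\<Oplus>\<^bsub>M\<^esub>j\<in>S. c S j \<odot>\<^bsub>M\<^esub> e j)"
          using h_ray[OF assms(9)[OF psubset.hyps psubset.prems(1) 3] mS] by (simp add: m)
      qed
    qed
  qed
  then have "linear_form_on R M (carrier M) h"
    using e span h by (intro linear_form_on_carrierI) auto
  then show ?thesis
    unfolding h_def using f by (intro affine_linear_on_carrierI) auto
qed

end
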